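(* Let $n\ge2$ and let $E\subset\mathbb{R}^n$ be a nonempty compact uniformly porous set. Then there are constants $0<c<C<\infty$ and $i_0\in\mathbb{N}$, depending only on the uniform porosity data of $E$, such that for all integers $i\ge i_0$, $$c\,2^{in}\,m(E(2^{-i}))\le\widetilde{N}_i\le C\,2^{in}\,m(E(2^{-i})).$$
   Context: $m$ is $n$-dimensional Lebesgue measure, and for $s>0$, $E(s)=\{x\in\mathbb{R}^n: d(x,E)\le s\}$. A set $E\subset\mathbb{R}^n$ is $(p,r_0)$-uniformly porous ($p,r_0>0$) if for all $x\in E$ and $0<r<r_0$ there is $y\in B^n(x,r)$ (open Euclidean ball) with $d(y,E)\ge p\,r$. $E$ is uniformly porous if it is $(p,r_0)$-uniformly porous for some $p,r_0>0$; the uniform porosity data are $p,r_0$ and $n$. Whitney decomposition: for a nonempty closed $E\subset\mathbb{R}^n$, write $\mathbb{R}^n\setminus E=\bigcup_{i\in\mathbb{Z}}\bigcup_{j=1}^{N_i}Q^i_j$ with closed dyadic cubes $Q_j^i$ such that (1) each $Q_j^i$ has faces parallel to the coordinate planes and edge length $2^{-i}$; (2) the interiors of distinct cubes in the decomposition are disjoint; (3) $2^{-i}\sqrt n\le d(Q_j^i,E)\le 2^{2-i}\sqrt n$. Thus $N_i$ is the number of cubes of generation $i$. Define $$\widetilde N_i=N_{i+k_0}+\dots+N_{i+k_1},$$ where $k_0$ is the smallest integer with $8\sqrt n\,2^{-k_0}\le1$ and $k_1$ is the largest integer with $80\sqrt n\,2^{-k_1}\ge1$. *)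

theory Defs
  imports "HOL-Analysis.Analysis"
begin

definition uniformly_porous :: "real \<Rightarrow> real \<Rightarrow> (real ^ 'n) set \<Rightarrow> bool" where
  "uniformly_porous p r0 E \<longleftrightarrow>
     0 < p \<and> 0 < r0 \<and>
     (\<forall>x\<in>E. \<forall>r. 0 < r \<and> r < r0 \<longrightarrow> (\<exists>y\<in>ball x r. p * r \<le> infdist y E))"

definition nbhd :: "(real ^ 'n) set \<Rightarrow> real \<Rightarrow> (real ^ 'n) set" where
  "nbhd E s = {x. infdist x E \<le> s}"

definition dyadic_cube :: "int \<Rightarrow> int ^ 'n \<Rightarrow> (real ^ 'n) set" where
  "dyadic_cube i a =
     cbox (\<chi> j. of_int (a $ j) * 2 powi (- i)) (\<chi> j. (of_int (a $ j) + 1) * 2 powi (- i))"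

text \<open>
  A decomposition is given by the map sending a generation \<open>i\<close> to the set of its cubes of
  edge length \<open>2 powi (- i)\<close>.
\<close>

definition whitney_decomposition :: "(real ^ 'n) set \<Rightarrow> (int \<Rightarrow> (real ^ 'n) set set) \<Rightarrow> bool" where
  "whitney_decomposition E W \<longleftrightarrow>
     (\<Union>i. \<Union>(W i)) = - E \<and>
     (\<forall>i. \<forall>Q\<in>W i. \<exists>a. Q = dyadic_cube i a) \<and>
     (\<forall>Q\<in>(\<Union>i. W i). \<forall>R\<in>(\<Union>i. W i). Q \<noteq> R \<longrightarrow> interior Q \<inter> interior R = {}) \<and>
     (\<forall>i. \<forall>Q\<in>W i. 2 powi (- i) * sqrt (real CARD('n)) \<le> setdist Q E
                 \<and> setdist Q E \<le> 2 powi (2 - i) * sqrt (real CARD('n)))"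

definition whitney_k0 :: "nat \<Rightarrow> int" where
  "whitney_k0 n = (LEAST k. 8 * sqrt (real n) * 2 powi (- k) \<le> 1)"

definition whitney_k1 :: "nat \<Rightarrow> int" where
  "whitney_k1 n = (GREATEST k. 1 \<le> 80 * sqrt (real n) * 2 powi (- k))"

text \<open>
  The number of cubes of a generation is taken with \<open>card\<close>, which is meaningful for bounded
  \<open>E\<close>: every generation of a Whitney decomposition of the complement is then finite.
\<close>

definition whitney_count :: "(int \<Rightarrow> (real ^ 'n) set set) \<Rightarrow> int \<Rightarrow> nat" where
  "whitney_count W i = (\<Sum>k = whitney_k0 CARD('n)..whitney_k1 CARD('n). card (W (i + k)))"

end

theory Submission
  imports Defs
begin

text \<open>
  Upper bound: the cubes counted have disjoint interiors, lie in the neighbourhood and have edge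
  length comparable to \<open>2 powi (- i)\<close>. Lower bound: by porosity, near each point of \<open>E\<close> there is a
  point at distance at least \<open>2 powi (- i) / 8\<close> from \<open>E\<close>; on the segment joining the two, some point is at
  distance exactly \<open>2 powi (- i) / 8\<close>, and the cube containing it is one of those counted. Hence
  balls of radius comparable to \<open>2 powi (- i)\<close>, one for each counted cube, cover the neighbourhood.
\<close>

section \<open>The range of generations counted\<close>

text \<open>The admissible \<open>k\<close> are exactly the integers from the ceiling of
  \<open>log 2 (8 * sqrt n)\<close> on, so \<open>LEAST\<close> on the integers is attained;
  \<open>n > 0\<close> makes the argument of the logarithm positive.\<close>

lemma whitney_k0_le_iff:
  assumes "n > 0"
  shows "whitney_k0 n \<le> k \<longleftrightarrow> 8 * sqrt (real n) \<le> 2 powi k"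
proof -
  have pos: "0 < 8 * sqrt (real n)"
    using assms by simp
  have iff: "\<lceil>log 2 (8 * sqrt (real n))\<rceil> \<le> k \<longleftrightarrow> 8 * sqrt (real n) \<le> 2 powi k" for k
    using pos by (simp add: ceiling_le_iff log_le_iff powr_real_of_int')
  have iff': "8 * sqrt (real n) * 2 powi (- k) \<le> 1 \<longleftrightarrow> 8 * sqrt (real n) \<le> 2 powi k" for k
    by (simp add: power_int_minus field_simps)
  have "whitney_k0 n = \<lceil>log 2 (8 * sqrt (real n))\<rceil>"
    unfolding whitney_k0_def iff' by (rule Least_equality) (simp_all flip: iff)
  then show ?thesis
    by (simp add: iff)
qed

text \<open>Dually, the admissible \<open>k\<close> are the integers up to the floor of
  \<open>log 2 (80 * sqrt n)\<close>, so \<open>GREATEST\<close> is attained.\<close>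

lemma le_whitney_k1_iff:
  assumes "n > 0"
  shows "k \<le> whitney_k1 n \<longleftrightarrow> 2 powi k \<le> 80 * sqrt (real n)"
proof -
  have pos: "0 < 80 * sqrt (real n)"
    using assms by simp
  have iff: "k \<le> \<lfloor>log 2 (80 * sqrt (real n))\<rfloor> \<longleftrightarrow> 2 powi k \<le> 80 * sqrt (real n)" for k
    using pos by (simp add: le_floor_iff le_log_iff powr_real_of_int')
  have iff': "1 \<le> 80 * sqrt (real n) * 2 powi (- k) \<longleftrightarrow> 2 powi k \<le> 80 * sqrt (real n)" for k
    by (simp add: power_int_minus field_simps)
  have "whitney_k1 n = \<lfloor>log 2 (80 * sqrt (real n))\<rfloor>"
    unfolding whitney_k1_def iff' by (rule Greatest_equality) (simp_all flip: iff)
  then show ?thesis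
    by (simp add: iff)
qed

section \<open>Diameter and volume of dyadic cubes\<close>

lemma norm_le_sqrt_card_cart:
  fixes x :: "real ^ 'n::finite"
  assumes "\<And>j. \<bar>x $ j\<bar> \<le> b"
  shows "norm x \<le> sqrt (real CARD('n)) * b"
proof -
  \<comment> \<open>Index types are nonempty, so any index, here \<open>undefined\<close>, shows
    that \<open>b\<close> bounds an absolute value.\<close>
  have b: "0 \<le> b"
    using assms[of undefined] by linarith
  have "(\<Sum>j\<in>UNIV. (x $ j)\<^sup>2) \<le> (\<Sum>j\<in>(UNIV :: 'n set). b\<^sup>2)"
    using assms b by (intro sum_mono abs_le_square_iff[THEN iffD1]) auto
  then have "norm x \<le> sqrt (real CARD('n) * b\<^sup>2)"
    by (simp add: norm_vec_def L2_set_def)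
  then show ?thesis
    using b by (simp add: real_sqrt_mult)
qed

lemma dist_dyadic_cube_le:
  fixes x y :: "real ^ 'n::finite"
  assumes "x \<in> dyadic_cube i a" "y \<in> dyadic_cube i a"
  shows "dist x y \<le> 2 powi (- i) * sqrt (real CARD('n))"
proof -
  have "\<bar>(x - y) $ j\<bar> \<le> 2 powi (- i)" for j
  proof -
    have "of_int (a $ j) * 2 powi (- i) \<le> x $ j" "x $ j \<le> (of_int (a $ j) + 1) * 2 powi (- i)"
      "of_int (a $ j) * 2 powi (- i) \<le> y $ j" "y $ j \<le> (of_int (a $ j) + 1) * 2 powi (- i)"
      using assms by (auto simp: dyadic_cube_def mem_box_cart)
    then show ?thesis
      by (simp add: distrib_right)
  qed
  from norm_le_sqrt_card_cart[OF this] show ?thesis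
    by (simp add: dist_norm mult.commute)
qed

lemma dyadic_cube_nonempty: "dyadic_cube i a \<noteq> {}"
  by (auto simp: dyadic_cube_def interval_eq_empty_cart distrib_right not_less)

lemma measure_dyadic_cube:
  fixes a :: "int ^ 'n::finite"
  shows "measure lebesgue (dyadic_cube i a) = (2 powi (- i)) ^ CARD('n)"
proof -
  have "measure lebesgue (dyadic_cube i a) = measure lborel (dyadic_cube i a)"
    by (intro measure_completion) (simp add: dyadic_cube_def)
  also have "\<dots> = (\<Prod>j\<in>(UNIV :: 'n set). 2 powi (- i))"
    using content_cbox_cart[OF dyadic_cube_nonempty[of i a, unfolded dyadic_cube_def]]
    by (simp only: dyadic_cube_def vec_lambda_beta distrib_right mult_1 add_diff_cancel_left')
  finally show ?thesis
    by simp
qed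

section \<open>Neighbourhoods of \<open>E\<close> and distances from Whitney cubes\<close>

lemma compact_nbhd:
  assumes "E \<noteq> {}" "compact E" "0 < s"
  shows "compact (nbhd E s)"
  unfolding nbhd_def using assms by (rule compact_infdist_le)

lemma whitney_cube_dyadic:
  assumes "whitney_decomposition E W" "Q \<in> W i"
  obtains a where "Q = dyadic_cube i a"
proof -
  have "\<forall>i. \<forall>Q\<in>W i. \<exists>a. Q = dyadic_cube i a"
    using assms(1) unfolding whitney_decomposition_def by (elim conjE)
  with assms(2) show ?thesis
    using that by blast
qed

lemma whitney_interior_disjoint:
  assumes "whitney_decomposition E W" "Q \<in> W i" "R \<in> W j" "Q \<noteq> R"
  shows "interior Q \<inter> interior R = {}"
proof -
  have "\<forall>Q\<in>(\<Union>i. W i). \<forall>R\<in>(\<Union>i. W i). Q \<noteq> R \<longrightarrow> interior Q \<inter> interior R = {}"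
    using assms(1) unfolding whitney_decomposition_def by (elim conjE)
  with assms(2-4) show ?thesis
    by blast
qed

lemma whitney_cube_exists:
  assumes "whitney_decomposition E W" "z \<notin> E"
  obtains i Q where "Q \<in> W i" "z \<in> Q"
proof -
  have "(\<Union>i. \<Union>(W i)) = - E"
    using assms(1) unfolding whitney_decomposition_def by (elim conjE)
  with assms(2) have "z \<in> (\<Union>i. \<Union>(W i))"
    by simp
  then show ?thesis
    using that by blast
qed

lemma whitney_cube_compact:
  assumes "whitney_decomposition E W" "Q \<in> W i"
  shows "compact Q"
  by (rule whitney_cube_dyadic[OF assms]) (simp add: dyadic_cube_def)

lemma whitney_infdist_ge:
  fixes E :: "(real ^ 'n::finite) set"
  assumes "whitney_decomposition E W" "Q \<in> W i" "z \<in> Q" "E \<noteq> {}"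
  shows "2 powi (- i) * sqrt (real CARD('n)) \<le> infdist z E"
proof -
  have "2 powi (- i) * sqrt (real CARD('n)) \<le> setdist Q E"
    using assms(1,2) by (simp add: whitney_decomposition_def)
  also have "\<dots> \<le> infdist z E"
    using assms by (simp add: infdist_eq_setdist setdist_subset_left)
  finally show ?thesis .
qed

text \<open>The factor 5 is 4 from the upper Whitney bound on \<open>setdist Q E\<close> plus 1 for
  the diameter of \<open>Q\<close>.\<close>

lemma whitney_infdist_le:
  fixes E :: "(real ^ 'n::finite) set"
  assumes "whitney_decomposition E W" "Q \<in> W i" "z \<in> Q" "E \<noteq> {}" "closed E"
  shows "infdist z E \<le> 5 * 2 powi (- i) * sqrt (real CARD('n))"
proof -
  obtain a where a: "Q = dyadic_cube i a"
    using assms by (rule_tac whitney_cube_dyadic)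
  have "setdist Q E \<le> 2 powi (2 - i) * sqrt (real CARD('n))"
    using assms(1,2) by (simp add: whitney_decomposition_def)
  moreover have "(2::real) powi (2 - i) = 4 * 2 powi (- i)"
    using power_int_add[of "2::real" 2 "- i"] by simp
  moreover obtain q e where "q \<in> Q" "e \<in> E" "dist q e = setdist Q E"
    using setdist_compact_closed[OF whitney_cube_compact[OF assms(1,2)] \<open>closed E\<close>] assms by blast
  moreover have "infdist z E \<le> dist z q + dist q e"
    using infdist_le[OF \<open>e \<in> E\<close>, of z] dist_triangle[of z e q] by linarith
  moreover have "dist z q \<le> 2 powi (- i) * sqrt (real CARD('n))"
    using dist_dyadic_cube_le assms \<open>q \<in> Q\<close> a by blast
  ultimately show ?thesis
    by (simp add: algebra_simps)
qed

section \<open>Upper bound: counting cubes by volume\<close>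

text \<open>Volumes of non-overlapping cubes add up inside \<open>S\<close>. The form for finite
  subfamilies is chosen because finiteness of \<open>W k\<close> is itself derived from this
  bound.\<close>

lemma whitney_generation_subset_card_le:
  fixes E :: "(real ^ 'n::finite) set"
  assumes W: "whitney_decomposition E W" and F: "finite F" "F \<subseteq> W k"
    and S: "S \<in> lmeasurable" "\<Union>F \<subseteq> S"
  shows "real (card F) * (2 powi (- k)) ^ CARD('n) \<le> measure lebesgue S"
proof -
  have dyadic: "\<exists>a. Q = dyadic_cube k a" if "Q \<in> F" for Q
    using W F that whitney_cube_dyadic by blast
  have meas: "Q \<in> lmeasurable" if "Q \<in> F" for Q
    using W F that whitney_cube_compact lmeasurable_compact by blast
  have "pairwise (\<lambda>Q R. negligible (Q \<inter> R)) F"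
  proof (rule pairwiseI)
    fix Q R assume QR: "Q \<in> F" "R \<in> F" "Q \<noteq> R"
    then have "interior Q \<inter> interior R = {}"
      using F by (intro whitney_interior_disjoint[OF W]) auto
    \<comment> \<open>Convexity turns empty interior into measure zero.\<close>
    moreover have "convex (Q \<inter> R)"
      using dyadic QR by (metis convex_Int convex_box(1) dyadic_cube_def)
    ultimately show "negligible (Q \<inter> R)"
      by (simp add: negligible_convex_interior)
  qed
  then have "measure lebesgue (\<Union>F) = (\<Sum>Q\<in>F. measure lebesgue Q)"
    using F meas by (intro measure_negligible_finite_Union) auto
  also have "\<dots> = (\<Sum>Q\<in>F. (2 powi (- k)) ^ CARD('n))"
    using dyadic measure_dyadic_cube by (intro sum.cong) blast+
  finally have "real (card F) * (2 powi (- k)) ^ CARD('n) = measure lebesgue (\<Union>F)"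
    by simp
  also have "\<dots> \<le> measure lebesgue S"
    using F S meas by (intro measure_mono_fmeasurable) (auto intro!: fmeasurableD fmeasurable.finite_Union)
  finally show ?thesis .
qed

text \<open>The volume bound caps the size of all finite subfamilies uniformly, which forces
  \<open>W k\<close> to be finite; then \<open>W k\<close> itself may be taken as the
  subfamily.\<close>

lemma whitney_generation_card_le:
  fixes E :: "(real ^ 'n::finite) set"
  assumes W: "whitney_decomposition E W" and S: "S \<in> lmeasurable" "\<Union>(W k) \<subseteq> S"
  shows "finite (W k)" "real (card (W k)) * (2 powi (- k)) ^ CARD('n) \<le> measure lebesgue S"
proof -
  have bound: "real (card F) * (2 powi (- k)) ^ CARD('n) \<le> measure lebesgue S"
    if "finite F" "F \<subseteq> W k" for F
    using whitney_generation_subset_card_le[OF W that S(1)] S(2) that by blast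
  have "card F \<le> nat \<lceil>measure lebesgue S / (2 powi (- k)) ^ CARD('n)\<rceil>"
    if "F \<subseteq> W k" "finite F" for F
  proof -
    have "real (card F) \<le> measure lebesgue S / (2 powi (- k)) ^ CARD('n)"
      using bound[OF that(2,1)] by (simp add: pos_le_divide_eq)
    then show ?thesis
      by linarith
  qed
  then show "finite (W k)"
    using finite_if_finite_subsets_card_bdd by blast
  then show "real (card (W k)) * (2 powi (- k)) ^ CARD('n) \<le> measure lebesgue S"
    by (rule bound) simp
qed

text \<open>For \<open>k\<close> from \<open>whitney_k0\<close> on,
  \<open>5 * 2 powi (- (i + k)) * sqrt n\<close> is at most 5/8 of
  \<open>2 powi (- i)\<close>.\<close>

lemma whitney_cubes_subset_nbhd:
  fixes E :: "(real ^ 'n::finite) set"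
  assumes W: "whitney_decomposition E W" and E: "E \<noteq> {}" "closed E"
    and k: "whitney_k0 CARD('n) \<le> k"
  shows "\<Union>(W (i + k)) \<subseteq> nbhd E (2 powi (- i))"
proof
  fix z assume "z \<in> \<Union>(W (i + k))"
  then obtain Q where Q: "Q \<in> W (i + k)" "z \<in> Q"
    by blast
  have "8 * sqrt (real CARD('n)) \<le> 2 powi k"
    using k by (subst (asm) whitney_k0_le_iff) auto
  then have "8 * sqrt (real CARD('n)) * 2 powi (- k) \<le> 1"
    by (simp add: power_int_minus field_simps)
  then have small: "5 * (2 powi (- k) * sqrt (real CARD('n))) \<le> 1"
    by (simp add: mult_ac)
  have "infdist z E \<le> 5 * 2 powi (- (i + k)) * sqrt (real CARD('n))"
    by (rule whitney_infdist_le[OF W Q E])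
  also have "\<dots> = 2 powi (- i) * (5 * (2 powi (- k) * sqrt (real CARD('n))))"
    using power_int_add[of "2::real" "- i" "- k"] by simp
  also have "\<dots> \<le> 2 powi (- i)"
    using small by (simp add: mult_left_le)
  finally show "z \<in> nbhd E (2 powi (- i))"
    by (simp add: nbhd_def)
qed

text \<open>The volume bound is applied to each counted generation with the neighbourhood as
  \<open>S\<close>; the sum over \<open>k\<close> is a constant determined by the dimension
  alone.\<close>

lemma whitney_count_le:
  fixes E :: "(real ^ 'n::finite) set"
  assumes W: "whitney_decomposition E W" and E: "E \<noteq> {}" "compact E"
  shows "real (whitney_count W i)
    \<le> (\<Sum>k = whitney_k0 CARD('n)..whitney_k1 CARD('n). (2 powi k) ^ CARD('n))
       * 2 powi (i * int CARD('n)) * measure lebesgue (nbhd E (2 powi (- i)))"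
proof -
  let ?m = "measure lebesgue (nbhd E (2 powi (- i)))"
  have "real (card (W (i + k))) \<le> (2 powi k) ^ CARD('n) * (2 powi (i * int CARD('n)) * ?m)"
    if "k \<in> {whitney_k0 CARD('n)..whitney_k1 CARD('n)}" for k
  proof -
    have "real (card (W (i + k))) * (2 powi (- (i + k))) ^ CARD('n) \<le> ?m"
      using whitney_cubes_subset_nbhd[OF W E(1) compact_imp_closed[OF E(2)]] that
      by (intro whitney_generation_card_le[OF W]) (auto intro!: lmeasurable_compact compact_nbhd E)
    moreover have "(2::real) powi (- (i + k)) = inverse (2 powi i * 2 powi k)"
      by (simp only: power_int_minus) (simp add: power_int_add)
    ultimately have "real (card (W (i + k))) * inverse ((2 powi i) ^ CARD('n) * (2 powi k) ^ CARD('n)) \<le> ?m"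
      by (simp only: power_inverse power_mult_distrib)
    then have "real (card (W (i + k))) \<le> (2 powi k) ^ CARD('n) * ((2 powi i) ^ CARD('n) * ?m)"
      by (simp add: field_simps)
    then show ?thesis
      by (simp add: power_int_mult)
  qed
  then have "real (whitney_count W i) \<le> (\<Sum>k = whitney_k0 CARD('n)..whitney_k1 CARD('n).
      (2 powi k) ^ CARD('n) * (2 powi (i * int CARD('n)) * ?m))"
    unfolding whitney_count_def of_nat_sum by (rule sum_mono)
  then show ?thesis
    by (simp only: sum_distrib_right mult.assoc)
qed

section \<open>Lower bound: covering by balls centred in counted cubes\<close>

text \<open>The distance to \<open>E\<close> is continuous on the segment from \<open>x\<close>,
  where it is 0, to a porosity point \<open>y\<close>, where it is at least \<open>s\<close>; the
  intermediate value theorem gives \<open>z\<close>.\<close>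

lemma uniformly_porous_point_at_distance:
  assumes "uniformly_porous p r0 E" "x \<in> E" "0 < s" "s < p * r0"
  obtains z where "dist x z \<le> s / p" "infdist z E = s"
proof -
  have p: "0 < p"
    using assms unfolding uniformly_porous_def by blast
  \<comment> \<open>Porosity is applied at radius \<open>s / p\<close>, so that the hole has
    distance at least \<open>s\<close> from \<open>E\<close>.\<close>
  have "0 < s / p" "s / p < r0"
    using assms p by (simp_all add: pos_divide_less_eq mult.commute)
  then obtain y where y: "y \<in> ball x (s / p)" "p * (s / p) \<le> infdist y E"
    using assms unfolding uniformly_porous_def by blast
  let ?g = "\<lambda>t. x + t *\<^sub>R (y - x)"
  have "\<exists>t. 0 \<le> t \<and> t \<le> 1 \<and> infdist (?g t) E = s"
  proof (rule IVT')
    show "continuous_on {0..1} (\<lambda>t. infdist (?g t) E)"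
      by (intro continuous_intros)
  qed (use assms y p in simp_all)
  then obtain t where t: "0 \<le> t" "t \<le> 1" "infdist (?g t) E = s"
    by blast
  have "dist x (?g t) = t * dist x y"
    using t by (simp add: dist_norm norm_minus_commute)
  also have "\<dots> \<le> dist x y"
    using t by (simp add: mult_left_le_one_le)
  also have "\<dots> \<le> s / p"
    using y by simp
  finally show ?thesis
    using that t by blast
qed

text \<open>At this distance the two Whitney bounds pin the generation \<open>i + k\<close> of the
  cube through \<open>z\<close>: they give
  \<open>8 * sqrt n \<le> 2 powi k \<le> 40 * sqrt n\<close>, inside the window from
  \<open>whitney_k0\<close> to \<open>whitney_k1\<close>.\<close>

lemma whitney_cube_at_distance:
  fixes E :: "(real ^ 'n::finite) set"
  assumes W: "whitney_decomposition E W" and E: "E \<noteq> {}" "closed E"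
    and z: "infdist z E = 2 powi (- i) / 8"
  obtains k Q where "k \<in> {whitney_k0 CARD('n)..whitney_k1 CARD('n)}" "Q \<in> W (i + k)" "z \<in> Q"
proof -
  have "z \<notin> E"
  proof
    assume "z \<in> E"
    then have "infdist z E = 0"
      by (rule infdist_zero)
    with z show False
      by simp
  qed
  then obtain j Q where Q: "Q \<in> W j" "z \<in> Q"
    by (rule whitney_cube_exists[OF W])
  define k where "k = j - i"
  have j: "j = i + k"
    by (simp add: k_def)
  have eq: "(2::real) powi (- j) = 2 powi (- i) * 2 powi (- k)"
    using power_int_add[of "2::real" "- i" "- k"] by (simp add: j)
  have "2 powi (- i) * (2 powi (- k) * sqrt (real CARD('n))) \<le> 2 powi (- i) * (1 / 8)"
    using whitney_infdist_ge[OF W Q E(1)] z eq by (simp add: mult.assoc)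
  then have lower: "2 powi (- k) * sqrt (real CARD('n)) \<le> 1 / 8"
    by (simp add: mult_le_cancel_left_pos)
  have "2 powi (- i) * (1 / 8) \<le> 2 powi (- i) * (5 * (2 powi (- k) * sqrt (real CARD('n))))"
    using whitney_infdist_le[OF W Q E] z eq by (simp add: mult_ac)
  then have upper: "1 / 8 \<le> 5 * (2 powi (- k) * sqrt (real CARD('n)))"
    by (simp add: mult_le_cancel_left_pos)
  have "8 * sqrt (real CARD('n)) \<le> 2 powi k"
    using lower by (simp add: power_int_minus field_simps)
  moreover have "2 powi k \<le> 40 * sqrt (real CARD('n))"
    using upper by (simp add: power_int_minus field_simps)
  then have "2 powi k \<le> 80 * sqrt (real CARD('n))"
    using real_sqrt_ge_zero[of "real CARD('n)"] by linarith
  ultimately have "k \<in> {whitney_k0 CARD('n)..whitney_k1 CARD('n)}"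
    by (simp add: whitney_k0_le_iff le_whitney_k1_iff)
  then show ?thesis
    using that Q j by blast
qed

text \<open>In units of \<open>2 powi (- i)\<close> the covering radius adds up three steps: 1 from
  \<open>x\<close> to a nearest point \<open>e\<close> of \<open>E\<close>,
  \<open>1 / (8 * p)\<close> from \<open>e\<close> to \<open>z\<close>, and 1/8 from
  \<open>z\<close> to the chosen point of its cube.\<close>

lemma measure_nbhd_le_whitney_count:
  fixes E :: "(real ^ 'n::finite) set"
  assumes W: "whitney_decomposition E W" and E: "E \<noteq> {}" "compact E"
    and porous: "uniformly_porous p r0 E" and i: "2 powi (- i) / 8 < p * r0"
  shows "measure lebesgue (nbhd E (2 powi (- i)))
    \<le> real (whitney_count W i) *
       (unit_ball_vol (real CARD('n)) * ((9 / 8 + 1 / (8 * p)) * 2 powi (- i)) ^ CARD('n))"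
proof -
  let ?K = "{whitney_k0 CARD('n)..whitney_k1 CARD('n)}"
  let ?R = "(9 / 8 + 1 / (8 * p)) * 2 powi (- i)"
  \<comment> \<open>Tagging cubes with their generation makes \<open>card I\<close> the sum of
    cardinalities without any disjointness argument.\<close>
  define I where "I = (SIGMA k:?K. W (i + k))"
  \<comment> \<open>A centre depending on the cube alone, not on \<open>x\<close> or
    \<open>z\<close>, leaves one ball per cube.\<close>
  define q where "q Q = (SOME x. x \<in> Q)" for Q :: "(real ^ 'n) set"
  have p: "0 < p"
    using porous unfolding uniformly_porous_def by blast
  have R: "0 \<le> ?R"
    using p by simp
  have closed: "closed E"
    using E by (simp add: compact_imp_closed)
  have q: "q Q \<in> Q" if "Q \<in> W j" for j Q
    using whitney_cube_dyadic[OF W that] dyadic_cube_nonempty unfolding q_def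
    by (metis ex_in_conv someI)
  \<comment> \<open>Finiteness rules out the default value 0 of \<open>card\<close> on infinite
    sets.\<close>
  have fin: "finite (W (i + k))" if "k \<in> ?K" for k
    using whitney_cubes_subset_nbhd[OF W E(1) closed] that
    by (intro whitney_generation_card_le(1)[OF W, of "nbhd E (2 powi (- i))"])
       (auto intro!: lmeasurable_compact compact_nbhd E)
  then have I: "finite I" "card I = whitney_count W i"
    unfolding I_def whitney_count_def by (auto intro!: card_SigmaI)
  have "nbhd E (2 powi (- i)) \<subseteq> (\<Union>x\<in>I. cball (q (snd x)) ?R)"
  proof
    fix x assume "x \<in> nbhd E (2 powi (- i))"
    then have "infdist x E \<le> 2 powi (- i)"
      by (simp add: nbhd_def)
    moreover obtain e where "e \<in> E" "infdist x E = dist x e"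
      using infdist_attains_inf[OF closed E(1)] .
    ultimately have e: "e \<in> E" "dist x e \<le> 2 powi (- i)"
      by simp_all
    obtain z where z: "dist e z \<le> 2 powi (- i) / 8 / p" "infdist z E = 2 powi (- i) / 8"
      by (rule uniformly_porous_point_at_distance[OF porous e(1) _ i]) auto
    obtain k Q where kQ: "k \<in> ?K" "Q \<in> W (i + k)" "z \<in> Q"
      by (rule whitney_cube_at_distance[OF W E(1) closed z(2)])
    obtain a where a: "Q = dyadic_cube (i + k) a"
      using whitney_cube_dyadic[OF W kQ(2)] .
    have "dist z (q Q) \<le> 2 powi (- (i + k)) * sqrt (real CARD('n))"
      using dist_dyadic_cube_le q[OF kQ(2)] kQ(3) a by metis
    \<comment> \<open>The lower Whitney bound makes the diameter of the cube at most the distance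
      from \<open>z\<close> to \<open>E\<close>.\<close>
    also have "\<dots> \<le> 2 powi (- i) / 8"
      using whitney_infdist_ge[OF W kQ(2,3) E(1)] z(2) by simp
    finally have "dist z (q Q) \<le> 2 powi (- i) / 8" .
    moreover have "dist x (q Q) \<le> dist x e + dist e z + dist z (q Q)"
      using dist_triangle[of x "q Q" z] dist_triangle[of x z e] by linarith
    moreover have "?R = 2 powi (- i) + 2 powi (- i) / 8 / p + 2 powi (- i) / 8"
      by (simp add: field_simps)
    ultimately have "x \<in> cball (q Q) ?R"
      using e z by (simp add: dist_commute)
    then show "x \<in> (\<Union>x\<in>I. cball (q (snd x)) ?R)"
      using kQ by (force simp: I_def)
  qed
  then have "measure lebesgue (nbhd E (2 powi (- i)))
      \<le> measure lebesgue (\<Union>x\<in>I. cball (q (snd x)) ?R)"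
    using I E
    by (intro measure_mono_fmeasurable)
       (auto intro!: fmeasurableD lmeasurable_compact compact_nbhd fmeasurable.finite_UN)
  also have "\<dots> \<le> (\<Sum>x\<in>I. measure lebesgue (cball (q (snd x)) ?R))"
    using I by (intro measure_UNION_le) auto
  also have "\<dots> = real (card I) * (unit_ball_vol (real CARD('n)) * ?R ^ CARD('n))"
    using content_cball[OF R, where 'a = "real ^ 'n"] by simp
  finally show ?thesis
    using I by simp
qed

theorem lemma4p2:
  fixes p r0 :: real
  assumes "CARD('n::finite) \<ge> 2" and "p > 0" and "r0 > 0"
  shows "\<exists>(c::real) (C::real) (i0::nat). 0 < c \<and> c < C \<and>
    (\<forall>(E::(real ^ 'n) set) W.
       E \<noteq> {} \<and> compact E \<and> uniformly_porous p r0 E \<and> whitney_decomposition E W \<longrightarrow>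
       (\<forall>i::int. i \<ge> int i0 \<longrightarrow>
          c * 2 powi (i * int CARD('n)) * measure lebesgue (nbhd E (2 powi (- i)))
            \<le> real (whitney_count W i) \<and>
          real (whitney_count W i)
            \<le> C * 2 powi (i * int CARD('n)) * measure lebesgue (nbhd E (2 powi (- i)))))"
proof -
  let ?n = "CARD('n)"
  \<comment> \<open>The volume of one covering ball with the scale \<open>2 powi (- i)\<close>
    factored out; \<open>c\<close> will be \<open>1 / V\<close>.\<close>
  define V where "V = unit_ball_vol (real ?n) * (9 / 8 + 1 / (8 * p)) ^ ?n"
  define U :: real where "U = (\<Sum>k = whitney_k0 ?n..whitney_k1 ?n. (2 powi k) ^ ?n)"
  have V: "0 < V"
    unfolding V_def using assms by (intro mult_pos_pos zero_less_power add_pos_pos) auto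
  have U: "0 \<le> U"
    unfolding U_def by (intro sum_nonneg) simp
  \<comment> \<open>From \<open>i0\<close> on, the distance \<open>2 powi (- i) / 8\<close> is below
    \<open>p * r0\<close>, as porosity at radius \<open>2 powi (- i) / (8 * p)\<close>
    requires.\<close>
  obtain i0 :: nat where i0: "(1 / 2) ^ i0 < 8 * (p * r0)"
    using real_arch_pow_inv[of "8 * (p * r0)" "1 / 2"] assms by auto
  have lower: "1 / V * 2 powi (i * int ?n) * measure lebesgue (nbhd E (2 powi (- i)))
      \<le> real (whitney_count W i)"
    if E: "E \<noteq> {}" "compact E" "uniformly_porous p r0 E" "whitney_decomposition E W"
      and i: "int i0 \<le> i" for E :: "(real ^ 'n) set" and W i
  proof -
    have "(2::real) powi (- i) \<le> 2 powi (- int i0)"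
      using i by (intro power_int_increasing) auto
    also have "\<dots> = (1 / 2) ^ i0"
      by (simp add: power_int_minus power_one_over inverse_eq_divide)
    finally have "2 powi (- i) / 8 < p * r0"
      using i0 by linarith
    from measure_nbhd_le_whitney_count[OF E(4,1,2,3) this]
    have "measure lebesgue (nbhd E (2 powi (- i)))
        \<le> real (whitney_count W i) * (V * (2 powi (- i)) ^ ?n)"
      by (simp only: V_def power_mult_distrib mult.assoc)
    moreover have "(2 powi (- i)) ^ ?n = inverse ((2::real) powi (i * int ?n))"
      by (simp add: power_int_minus power_int_mult power_inverse)
    ultimately show ?thesis
      using V by (simp add: field_simps)
  qed
  \<comment> \<open>The constant \<open>U\<close> is enlarged by \<open>2 / V\<close> so that
    \<open>C\<close> strictly exceeds \<open>1 / V\<close>, given only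
    \<open>0 \<le> U\<close>.\<close>
  have upper: "real (whitney_count W i)
      \<le> (U + 2 / V) * 2 powi (i * int ?n) * measure lebesgue (nbhd E (2 powi (- i)))"
    if "E \<noteq> {}" "compact E" "whitney_decomposition E W" for E :: "(real ^ 'n) set" and W i
  proof -
    have "real (whitney_count W i)
        \<le> U * (2 powi (i * int ?n) * measure lebesgue (nbhd E (2 powi (- i))))"
      using whitney_count_le[OF that(3,1,2)] by (simp only: U_def mult.assoc)
    also have "\<dots> \<le> (U + 2 / V) * (2 powi (i * int ?n) * measure lebesgue (nbhd E (2 powi (- i))))"
      using V by (intro mult_right_mono) auto
    finally show ?thesis
      by (simp only: mult.assoc)
  qed
  have "0 < 1 / V"
    using V by simp
  moreover from this have "1 / V < U + 2 / V"
    using U by linarith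
  ultimately show ?thesis
    using lower upper by blast
qed

end
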